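(* For each $k\in\{3,4,5\}$, a matrix $A\in\mathbb{N}^{2\times 2}$ is the color adjacency matrix of a perfect 2-coloring of some connected $k$-regular graph if and only if $A$ is equivalent to one of the following matrices (which, for each $k$, are pairwise inequivalent). $k=3$ (6 matrices): $\begin{pmatrix}0&3\\1&2\end{pmatrix}$, $\begin{pmatrix}0&3\\2&1\end{pmatrix}$, $\begin{pmatrix}0&3\\3&0\end{pmatrix}$, $\begin{pmatrix}1&2\\1&2\end{pmatrix}$, $\begin{pmatrix}1&2\\2&1\end{pmatrix}$, $\begin{pmatrix}2&1\\1&2\end{pmatrix}$. $k=4$ (10 matrices): $\begin{pmatrix}0&4\\1&3\end{pmatrix}$, $\begin{pmatrix}0&4\\2&2\end{pmatrix}$, $\begin{pmatrix}0&4\\3&1\end{pmatrix}$, $\begin{pmatrix}0&4\\4&0\end{pmatrix}$, $\begin{pmatrix}1&3\\1&3\end{pmatrix}$, $\begin{pmatrix}1&3\\2&2\end{pmatrix}$, $\begin{pmatrix}1&3\\3&1\end{pmatrix}$, $\begin{pmatrix}2&2\\1&3\end{pmatrix}$, $\begin{pmatrix}2&2\\2&2\end{pmatrix}$, $\begin{pmatrix}3&1\\1&3\end{pmatrix}$. $k=5$ (15 matrices): $\begin{pmatrix}0&5\\1&4\end{pmatrix}$, $\begin{pmatrix}0&5\\2&3\end{pmatrix}$, $\begin{pmatrix}0&5\\3&2\end{pmatrix}$, $\begin{pmatrix}0&5\\4&1\end{pmatrix}$, $\begin{pmatrix}0&5\\5&0\end{pmatrix}$, $\begin{pmatrix}1&4\\1&4\end{pmatrix}$,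 $\begin{pmatrix}1&4\\2&3\end{pmatrix}$, $\begin{pmatrix}1&4\\3&2\end{pmatrix}$, $\begin{pmatrix}1&4\\4&1\end{pmatrix}$, $\begin{pmatrix}2&3\\1&4\end{pmatrix}$, $\begin{pmatrix}2&3\\2&3\end{pmatrix}$, $\begin{pmatrix}2&3\\3&2\end{pmatrix}$, $\begin{pmatrix}3&2\\1&4\end{pmatrix}$, $\begin{pmatrix}3&2\\2&3\end{pmatrix}$, $\begin{pmatrix}4&1\\1&4\end{pmatrix}$.
   Context: $\mathbb{N}$ denotes the nonnegative integers. All graphs are finite, undirected, simple and loop-free. An $m$-coloring of a graph $G=(V,E)$ is a partition of $V$ into $m$ disjoint nonempty sets $V_1,\ldots,V_m$ (the color classes; adjacent vertices may have the same color). The coloring is perfect if for all $i,j$ the number of neighbors of color $j$ of any vertex of color $i$ is a constant $a_{ij}$; the matrix $A=(a_{ij})_{1\le i,j\le m}$ is then called the color adjacency matrix of the perfect coloring. Two $m\times m$ matrices $A,B$ are equivalent (differ by a permutation of colors) if $B=PAP^{-1}$ for some permutation matrix $P$. *)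

theory Defs
  imports "HOL-Analysis.Analysis" "HOL-Library.Infinite_Typeclass" "Graph_Theory.Digraph_Component"
begin

text \<open>
  Finite, undirected, simple, loop-free graphs are the symmetric loop-free pair digraphs of
  the locale \<^locale>\<open>pair_graph\<close>: an undirected edge is represented by its two orientations, so
  the neighbours of a vertex are its out-neighbours and its degree is its out-degree.
\<close>

definition regular_graph :: "'v pair_pre_digraph \<Rightarrow> nat \<Rightarrow> bool" where
  "regular_graph G k \<longleftrightarrow> (\<forall>v \<in> pverts G. out_degree (with_proj G) v = k)"

definition nbrs :: "'v pair_pre_digraph \<Rightarrow> 'v \<Rightarrow> 'v set" where
  "nbrs G v = {w. (v, w) \<in> parcs G}"

text \<open>Colorings are indexed by a finite type of colors; an \<open>m\<close>-coloring is the case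
  \<open>CARD('m) = m\<close>. The type \<open>2\<close> used for 2-colorings has the elements \<open>1\<close> and \<open>2\<close>.\<close>

definition coloring :: "'v pair_pre_digraph \<Rightarrow> ('m::finite \<Rightarrow> 'v set) \<Rightarrow> bool" where
  "coloring G V \<longleftrightarrow>
     (\<forall>i. V i \<noteq> {}) \<and> disjoint_family V \<and> (\<Union>i. V i) = pverts G"

definition perfect_coloring :: "'v pair_pre_digraph \<Rightarrow> ('m::finite \<Rightarrow> 'v set) \<Rightarrow> bool" where
  "perfect_coloring G V \<longleftrightarrow>
     coloring G V \<and> (\<forall>i j. \<exists>a. \<forall>v \<in> V i. card (nbrs G v \<inter> V j) = a)"

definition color_adjacency_matrix ::
    "'v pair_pre_digraph \<Rightarrow> ('m::finite \<Rightarrow> 'v set) \<Rightarrow> nat^'m^'m \<Rightarrow> bool" where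
  "color_adjacency_matrix G V A \<longleftrightarrow>
     perfect_coloring G V \<and> (\<forall>i j. \<forall>v \<in> V i. card (nbrs G v \<inter> V j) = A $ i $ j)"

definition permutation_matrix :: "nat^'m^'m \<Rightarrow> bool" where
  "permutation_matrix P \<longleftrightarrow>
     (\<exists>p. p permutes (UNIV :: 'm set) \<and> P = (\<chi> i j. if j = p i then 1 else 0))"

definition equivalent_matrices :: "nat^'m^'m \<Rightarrow> nat^'m^'m \<Rightarrow> bool" where
  "equivalent_matrices A B \<longleftrightarrow>
     (\<exists>P. permutation_matrix P \<and> B = P ** A ** matrix_inv P)"

definition mat2 :: "nat \<Rightarrow> nat \<Rightarrow> nat \<Rightarrow> nat \<Rightarrow> nat^2^2" where
  "mat2 a b c d = vector [vector [a, b], vector [c, d]]"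

definition matrices3 :: "(nat^2^2) list" where
  "matrices3 =
     [mat2 0 3 1 2, mat2 0 3 2 1, mat2 0 3 3 0,
      mat2 1 2 1 2, mat2 1 2 2 1,
      mat2 2 1 1 2]"

definition matrices4 :: "(nat^2^2) list" where
  "matrices4 =
     [mat2 0 4 1 3, mat2 0 4 2 2, mat2 0 4 3 1, mat2 0 4 4 0,
      mat2 1 3 1 3, mat2 1 3 2 2, mat2 1 3 3 1,
      mat2 2 2 1 3, mat2 2 2 2 2,
      mat2 3 1 1 3]"

definition matrices5 :: "(nat^2^2) list" where
  "matrices5 =
     [mat2 0 5 1 4, mat2 0 5 2 3, mat2 0 5 3 2, mat2 0 5 4 1, mat2 0 5 5 0,
      mat2 1 4 1 4, mat2 1 4 2 3, mat2 1 4 3 2, mat2 1 4 4 1,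
      mat2 2 3 1 4, mat2 2 3 2 3, mat2 2 3 3 2,
      mat2 3 2 1 4, mat2 3 2 2 3,
      mat2 4 1 1 4]"

end

theory Submission
  imports Defs
begin

text \<open>
  Fix \<open>k\<close> and write \<open>a\<close>, \<open>b\<close>, \<open>c\<close>, \<open>d\<close> for the entries of \<open>A\<close>, row by row. Regularity forces
  \<open>a + b = c + d = k\<close>, and connectedness forces \<open>b, c > 0\<close>, as otherwise no edge would join the
  two color classes. These conditions are also sufficient (\<open>realizable_iff\<close>). To see this,
  take copies of the edgeless graph on the subsets of \<open>{..<N}\<close>, where \<open>N = max a d\<close>: \<open>c\<close> copies
  of color 1 and \<open>b\<close> copies of color 2. Join each vertex to the copies of the same
  subset in the other color; this gives the off-diagonal entries \<open>b\<close> and \<open>c\<close>. Then add, inside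
  each copy of color 1, the edges of the hypercube in the first \<open>a\<close> directions, and
  inside each copy of color 2 those in the first \<open>d\<close> directions. As \<open>N\<close> is the maximum, every
  hypercube direction is available in one of the two colors, which makes the graph connected.

  So the admissible matrices correspond to the pairs \<open>(a, d)\<close> with \<open>a, d < k\<close>, and the only
  nontrivial permutation of the colors swaps \<open>a\<close> and \<open>d\<close>. Hence the matrices with
  \<open>a \<le> d < k\<close> represent every class exactly once (\<open>classification\<close>), for
  every \<open>k\<close>; the three lists enumerate them for \<open>k = 3, 4, 5\<close>.
\<close>

section \<open>Equivalence of two-by-two matrices\<close>

lemma mat2_nth [simp]:
  "mat2 a b c d $ 1 $ 1 = a" "mat2 a b c d $ 1 $ 2 = b"
  "mat2 a b c d $ 2 $ 1 = c" "mat2 a b c d $ 2 $ 2 = d"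
  by (simp_all add: mat2_def)

lemma matrix2_eq_iff:
  "(A :: 'a^2^2) = B \<longleftrightarrow>
     A$1$1 = B$1$1 \<and> A$1$2 = B$1$2 \<and> A$2$1 = B$2$1 \<and> A$2$2 = B$2$2"
  by (auto simp: vec_eq_iff forall_2)

lemma matrix_inv_eqI:
  fixes A :: "'a::semiring_1^'n^'m"
  assumes "A ** B = mat 1" "B ** A = mat 1"
  shows "matrix_inv A = B"
proof -
  define C where "C = matrix_inv A"
  have C: "A ** C = mat 1 \<and> C ** A = mat 1"
    unfolding C_def matrix_inv_def by (rule someI) (use assms in blast)
  have "C = C ** (A ** B)"
    using assms by simp
  also have "\<dots> = B"
    using C by (simp add: matrix_mul_assoc)
  finally show ?thesis
    by (simp add: C_def)
qed

lemma conj_permutation_matrix: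
  fixes A :: "nat^'m^'m"
  assumes p: "p permutes UNIV"
  defines "P \<equiv> (\<chi> i j. if j = p i then 1 else 0) :: nat^'m^'m"
  shows "P ** A ** matrix_inv P = (\<chi> i j. A $ p i $ p j)"
proof -
  define Q :: "nat^'m^'m" where "Q = (\<chi> i j. if i = p j then 1 else 0)"
  have inj: "p i = p j \<longleftrightarrow> i = j" for i j
    using permutes_inj[OF p] by (auto dest: injD)
  have PM: "P ** M = (\<chi> i j. M $ p i $ j)" for M :: "nat^'m^'m"
    by (simp add: P_def matrix_matrix_mult_def vec_eq_iff mult_delta_left)
  have MQ: "M ** Q = (\<chi> i j. M $ i $ p j)" for M :: "nat^'m^'m"
    by (simp add: Q_def matrix_matrix_mult_def vec_eq_iff mult_delta_right)
  have QP: "Q ** P = mat 1"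
  proof -
    have "(\<Sum>k\<in>UNIV. Q $ i $ k * P $ k $ j) = (if i = j then 1 else 0)" for i j
    proof -
      have eq: "Q $ i $ k * P $ k $ j = (if k = inv p i then if i = j then 1 else 0 else 0)" for k
        by (auto simp: Q_def P_def permutes_inv_eq[OF p] inj eq_commute[of k])
      show ?thesis
        unfolding eq by simp
    qed
    then show ?thesis
      by (simp add: matrix_matrix_mult_def mat_def vec_eq_iff)
  qed
  have "matrix_inv P = Q"
    by (rule matrix_inv_eqI[OF _ QP]) (simp add: PM Q_def mat_def vec_eq_iff inj)
  then show ?thesis
    by (simp add: PM MQ)
qed

lemma equivalent_matrices_iff:
  "equivalent_matrices A B \<longleftrightarrow> (\<exists>p. p permutes UNIV \<and> B = (\<chi> i j. A $ p i $ p j))"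
  by (auto simp: equivalent_matrices_def permutation_matrix_def conj_permutation_matrix)

lemma permutes_2_iff: "(p :: 2 \<Rightarrow> 2) permutes UNIV \<longleftrightarrow> p = id \<or> p = Transposition.transpose 1 2"
proof
  assume "p permutes UNIV"
  then have "p 1 \<noteq> p 2"
    using inj_eq[OF permutes_inj, of p UNIV 1 2] by simp
  then show "p = id \<or> p = Transposition.transpose 1 2"
    using exhaust_2[of "p 1"] exhaust_2[of "p 2"] by (auto simp: fun_eq_iff forall_2)
qed (auto simp: permutes_id permutes_swap_id)

lemma equivalent_matrices_2_iff:
  "equivalent_matrices A B \<longleftrightarrow> B = A \<or> B = mat2 (A$2$2) (A$2$1) (A$1$2) (A$1$1)"
proof -
  have "equivalent_matrices A B \<longleftrightarrow>
      (\<exists>p\<in>{id, Transposition.transpose 1 2}. B = (\<chi> i j. A $ p i $ p j))"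
    by (auto simp: equivalent_matrices_iff permutes_2_iff)
  then show ?thesis
    by (simp add: matrix2_eq_iff)
qed

section \<open>Necessary conditions\<close>

lemma (in pair_graph) connected_iff_rtrancl:
  "Digraph_Component.connected (with_proj G) \<longleftrightarrow>
     pverts G \<noteq> {} \<and> (\<forall>u\<in>pverts G. \<forall>v\<in>pverts G. (u, v) \<in> (parcs G)\<^sup>*)"
  unfolding Digraph_Component.connected_def strongly_connected_def
  using reachable_mk_symmetric_eq[OF sym_arcs] by (auto simp: reachable_conv)

lemma out_degree_eq_card_nbrs: "out_degree (with_proj G) v = card (nbrs G v)"
proof -
  have "out_arcs (with_proj G) v = Pair v ` nbrs G v"
    by (auto simp: out_arcs_def nbrs_def)
  then show ?thesis
    by (simp add: out_degree_def card_image inj_on_def)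
qed

lemma color_adjacency_matrix_row_sum:
  assumes G: "pair_graph G" and "regular_graph G k" and A: "color_adjacency_matrix G V A"
  shows "(\<Sum>j\<in>UNIV. A $ i $ j) = k"
proof -
  interpret pair_graph G by fact
  from A have col: "coloring G V"
    and cnt: "\<And>i j v. v \<in> V i \<Longrightarrow> card (nbrs G v \<inter> V j) = A $ i $ j"
    by (auto simp: color_adjacency_matrix_def perfect_coloring_def)
  then obtain v where v: "v \<in> V i"
    by (meson coloring_def ex_in_conv)
  have sub: "nbrs G v \<subseteq> pverts G"
    by (auto simp: nbrs_def dest: in_arcsD2)
  then have fin: "finite (nbrs G v)"
    using pair_finite_verts finite_subset by blast
  have "k = card (nbrs G v)"
    using assms(2) col v by (auto simp: regular_graph_def coloring_def out_degree_eq_card_nbrs)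
  also have "nbrs G v = (\<Union>j. nbrs G v \<inter> V j)"
    using sub col by (auto simp: coloring_def)
  also have "card \<dots> = (\<Sum>j\<in>UNIV. card (nbrs G v \<inter> V j))"
    using col fin by (subst card_UN_disjoint) (auto simp: coloring_def disjoint_family_on_def)
  also have "\<dots> = (\<Sum>j\<in>UNIV. A $ i $ j)"
    using cnt v by simp
  finally show ?thesis ..
qed

lemma color_adjacency_matrix_off_diagonal:
  fixes V :: "2 \<Rightarrow> 'v set"
  assumes G: "pair_graph G" "Digraph_Component.connected (with_proj G)"
    and A: "color_adjacency_matrix G V A" and "i \<noteq> j"
  shows "A $ i $ j > 0"
proof (rule ccontr)
  assume "\<not> A $ i $ j > 0"
  interpret pair_graph G by fact
  from A have col: "coloring G V"
    and cnt: "\<And>v. v \<in> V i \<Longrightarrow> card (nbrs G v \<inter> V j) = A $ i $ j"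
    by (auto simp: color_adjacency_matrix_def perfect_coloring_def)
  have fin: "finite (nbrs G v)" for v
    by (rule finite_subset[OF _ pair_finite_verts]) (auto simp: nbrs_def dest: in_arcsD2)
  have verts: "pverts G = V i \<union> V j" and disj: "V i \<inter> V j = {}"
    using col \<open>i \<noteq> j\<close> exhaust_2[of i] exhaust_2[of j]
    by (auto simp: coloring_def UNIV_2 disjoint_family_on_def)
  have step: "w \<in> V i" if "v \<in> V i" "(v, w) \<in> parcs G" for v w
  proof -
    have "nbrs G v \<inter> V j = {}"
      using cnt[OF that(1)] fin[of v] \<open>\<not> A $ i $ j > 0\<close> by simp
    then show ?thesis
      using that verts in_arcsD2[of v w] by (auto simp: nbrs_def)
  qed
  obtain u v where u: "u \<in> V i" and v: "v \<in> V j"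
    using col by (meson coloring_def ex_in_conv)
  then have "(u, v) \<in> (parcs G)\<^sup>*"
    using G(2) verts by (simp add: connected_iff_rtrancl)
  then have "v \<in> V i"
    by (induction rule: rtrancl_induct) (use u step in auto)
  then show False
    using v disj by auto
qed

section \<open>Construction of the graphs\<close>

text \<open>
  The graph of the construction has vertices of a convenient concrete type; this lemma moves
  it into an arbitrary infinite type.
\<close>

lemma perfect_coloring_transfer:
  fixes E :: "('a \<times> 'a) set" and c :: "'a \<Rightarrow> 'm::finite"
  assumes W: "finite W" "E \<subseteq> W \<times> W" and "sym E" and "irrefl E"
    and conn: "\<And>u v. u \<in> W \<Longrightarrow> v \<in> W \<Longrightarrow> (u, v) \<in> E\<^sup>*"
    and onto: "c ` W = UNIV"
    and cnt: "\<And>u j. u \<in> W \<Longrightarrow> card {w. (u, w) \<in> E \<and> c w = j} = A $ c u $ j"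
    and sum: "\<And>i. (\<Sum>j\<in>UNIV. A $ i $ j) = k"
  shows "\<exists>(G :: 'v::infinite pair_pre_digraph) V.
    pair_graph G \<and> Digraph_Component.connected (with_proj G) \<and> regular_graph G k \<and>
    color_adjacency_matrix G V A"
proof -
  obtain f :: "'a \<Rightarrow> 'v" where f: "inj_on f W"
    using arb_inj_on_finite_infinite[OF W(1)] by blast
  define G where "G = \<lparr>pverts = f ` W, parcs = map_prod f f ` E\<rparr>"
  define V where "V i = f ` {u\<in>W. c u = i}" for i
  have "finite E"
    using W finite_subset by blast
  then have G: "pair_graph G"
    using W(1,2) \<open>sym E\<close> \<open>irrefl E\<close> inj_onD[OF f]
    by unfold_locales (fastforce simp: G_def symmetric_def sym_def irrefl_def)+
  interpret pair_graph G by fact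
  have "W \<noteq> {}"
    using onto by auto
  moreover have "(f u, f v) \<in> (parcs G)\<^sup>*" if "u \<in> W" "v \<in> W" for u v
    using conn[OF that]
    by (induction rule: rtrancl_induct) (auto simp: G_def intro: rtrancl_into_rtrancl)
  ultimately have con: "Digraph_Component.connected (with_proj G)"
    by (auto simp: connected_iff_rtrancl) (auto simp: G_def)
  have nbrs: "nbrs G (f u) = f ` {w. (u, w) \<in> E}" if "u \<in> W" for u
    using that W(2) inj_onD[OF f] by (fastforce simp: nbrs_def G_def)
  have "coloring G V"
    unfolding coloring_def
  proof (intro conjI allI)
    show "V i \<noteq> {}" for i
      using onto by (auto simp: V_def) (metis UNIV_I imageE)
    show "disjoint_family V"
      using inj_onD[OF f] by (auto simp: V_def disjoint_family_on_def)
    show "(\<Union>i. V i) = pverts G"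
      by (auto simp: V_def G_def)
  qed
  have card_V: "card (nbrs G (f u) \<inter> V j) = A $ c u $ j" if "u \<in> W" for u j
  proof -
    have "nbrs G (f u) \<inter> V j = f ` {w. (u, w) \<in> E \<and> c w = j}"
      unfolding nbrs[OF that] V_def using W(2) inj_onD[OF f] by fastforce
    moreover have "inj_on f {w. (u, w) \<in> E \<and> c w = j}"
      by (rule inj_on_subset[OF f]) (use W(2) in auto)
    ultimately show ?thesis
      using cnt[OF that] by (simp add: card_image)
  qed
  then have A: "color_adjacency_matrix G V A"
    using \<open>coloring G V\<close>
    by (auto simp: color_adjacency_matrix_def perfect_coloring_def V_def)
  have "card (nbrs G (f u)) = k" if "u \<in> W" for u
  proof -
    have "nbrs G (f u) = (\<Union>j. nbrs G (f u) \<inter> V j)"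
      unfolding nbrs[OF that] V_def using W(2) by auto
    moreover have "card (\<Union>j. nbrs G (f u) \<inter> V j) = (\<Sum>j\<in>UNIV. card (nbrs G (f u) \<inter> V j))"
      using W(1) inj_onD[OF f] by (subst card_UN_disjoint) (auto simp: V_def)
    ultimately show ?thesis
      using card_V[OF that] sum by simp
  qed
  then have "regular_graph G k"
    by (auto simp: regular_graph_def out_degree_eq_card_nbrs) (auto simp: G_def)
  with G con A show ?thesis
    by blast
qed

definition flip :: "'a \<Rightarrow> 'a set \<Rightarrow> 'a set" where
  "flip e x = (if e \<in> x then x - {e} else insert e x)"

lemma flip_flip [simp]: "flip e (flip e x) = x"
  by (auto simp: flip_def)

lemma flip_neq [simp]: "flip e x \<noteq> x" "x \<noteq> flip e x"
  by (auto simp: flip_def)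

lemma flip_inj: "flip e x = flip e' x \<Longrightarrow> e = e'"
  by (auto simp: flip_def split: if_splits)

lemma flip_subset: "x \<subseteq> M \<Longrightarrow> e \<in> M \<Longrightarrow> flip e x \<subseteq> M"
  by (auto simp: flip_def)

text \<open>
  A vertex \<open>(s, x, i)\<close> is the subset \<open>x\<close> of \<open>{..<N}\<close> in the \<open>i\<close>-th copy of color \<open>s\<close>. Here \<open>m s\<close> is
  the number of hypercube directions inside color \<open>s\<close> and \<open>n s\<close> the number of copies.
\<close>

definition cube_verts :: "nat \<Rightarrow> (2 \<Rightarrow> nat) \<Rightarrow> (2 \<times> nat set \<times> nat) set" where
  "cube_verts N n = {(s, x, i). x \<subseteq> {..<N} \<and> i < n s}"

definition cube_arcs ::
    "nat \<Rightarrow> (2 \<Rightarrow> nat) \<Rightarrow> (2 \<Rightarrow> nat) \<Rightarrow> ((2 \<times> nat set \<times> nat) \<times> (2 \<times> nat set \<times> nat)) set" where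
  "cube_arcs N m n = {((s, x, i), (t, y, j)).
     (s, x, i) \<in> cube_verts N n \<and> (t, y, j) \<in> cube_verts N n \<and>
     (s \<noteq> t \<and> x = y \<or> s = t \<and> i = j \<and> (\<exists>e < m s. y = flip e x))}"

lemma finite_cube_verts: "finite (cube_verts N n)"
proof (rule finite_subset)
  show "cube_verts N n \<subseteq> UNIV \<times> Pow {..<N} \<times> {..<n 1 + n 2}"
  proof (clarsimp simp: cube_verts_def)
    show "i < n 1 + n 2" if "i < n s" for i s
      using that exhaust_2[of s] by auto
  qed
qed simp

lemma sym_cube_arcs: "sym (cube_arcs N m n)"
  by (rule symI) (auto simp: cube_arcs_def intro: exI[where P = "\<lambda>e. _ e \<and> _ e"])

lemma irrefl_cube_arcs: "irrefl (cube_arcs N m n)"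
  by (auto simp: irrefl_def cube_arcs_def)

lemma card_cube_arcs_same:
  assumes "(s, x, i) \<in> cube_verts N n" "m s \<le> N"
  shows "card {w. ((s, x, i), w) \<in> cube_arcs N m n \<and> fst w = s} = m s"
proof -
  have "y < N" if "e < m s" "y \<in> flip e x" for e y
    using assms that flip_subset[of x "{..<N}" e] by (auto simp: cube_verts_def)
  then have "{w. ((s, x, i), w) \<in> cube_arcs N m n \<and> fst w = s} = (\<lambda>e. (s, flip e x, i)) ` {..<m s}"
    using assms by (auto simp: cube_arcs_def cube_verts_def)
  moreover have "inj (\<lambda>e. (s, flip e x, i))"
    by (auto simp: inj_def dest: flip_inj)
  ultimately show ?thesis
    by (simp add: card_image inj_on_subset)
qed

lemma card_cube_arcs_other:
  assumes "(s, x, i) \<in> cube_verts N n" "s \<noteq> t"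
  shows "card {w. ((s, x, i), w) \<in> cube_arcs N m n \<and> fst w = t} = n t"
proof -
  have "{w. ((s, x, i), w) \<in> cube_arcs N m n \<and> fst w = t} = (\<lambda>j. (t, x, j)) ` {..<n t}"
    using assms by (auto simp: cube_arcs_def cube_verts_def)
  then show ?thesis
    by (simp add: card_image inj_on_def)
qed

lemma cube_arcs_connected:
  assumes N: "N = max (m 1) (m 2)" and n: "\<And>s. n s > 0"
    and uv: "u \<in> cube_verts N n" "v \<in> cube_verts N n"
  shows "(u, v) \<in> (cube_arcs N m n)\<^sup>*"
proof -
  define R where "R = (cube_arcs N m n)\<^sup>*"
  have R_trans: "(a, c) \<in> R" if "(a, b) \<in> R" "(b, c) \<in> R" for a b c
    using that unfolding R_def by (rule rtrancl_trans)
  have R_sym: "(b, a) \<in> R" if "(a, b) \<in> R" for a b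
    using that sym_rtrancl[OF sym_cube_arcs] unfolding R_def by (rule symD[rotated])
  have cross: "((s, x, i), (t, x, j)) \<in> R"
    if "(s, x, i) \<in> cube_verts N n" "(t, x, j) \<in> cube_verts N n" "s \<noteq> t" for s t x i j
    using that unfolding R_def by (auto simp: cube_arcs_def)
  \<comment> \<open>Two copies of one color are joined through any copy of the other color.\<close>
  have copies: "((s, x, i), (t, x, j)) \<in> R"
    if "(s, x, i) \<in> cube_verts N n" "(t, x, j) \<in> cube_verts N n" for s t x i j
  proof (cases "s = t")
    case True
    obtain r where "r \<noteq> s"
      by (metis zero_neq_one)
    moreover have "(r, x, 0) \<in> cube_verts N n"
      using that n by (auto simp: cube_verts_def)
    ultimately show ?thesis
      using that True by (metis R_trans cross)
  qed (use that cross in auto)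
  have flip: "((s, x, i), (s, flip e x, i)) \<in> R"
    if x: "(s, x, i) \<in> cube_verts N n" and e: "e < N" for s x i e
  proof -
    \<comment> \<open>Move to a color in which the direction \<open>e\<close> is available.\<close>
    obtain t where t: "e < m t"
      using e N by (auto simp: max_def split: if_splits)
    have V: "(s, flip e x, i) \<in> cube_verts N n" "(t, x, 0) \<in> cube_verts N n"
      "(t, flip e x, 0) \<in> cube_verts N n"
      using x n flip_subset[of x "{..<N}" e] e by (auto simp: cube_verts_def)
    then have "((t, x, 0), (t, flip e x, 0)) \<in> R"
      using t unfolding R_def by (auto simp: cube_arcs_def)
    then show ?thesis
      using copies x V by (meson R_trans)
  qed
  have to_empty: "((s, x, i), (s, {}, i)) \<in> R" if "(s, x, i) \<in> cube_verts N n" for s x i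
  proof -
    have "finite x"
      using that finite_subset by (auto simp: cube_verts_def)
    then show ?thesis
      using that
    proof (induction x)
      case empty
      then show ?case
        by (simp add: R_def)
    next
      case (insert e x)
      then have "flip e (insert e x) = x"
        by (auto simp: flip_def)
      then have "((s, insert e x, i), (s, x, i)) \<in> R"
        using flip[of s "insert e x" i e] insert.prems by (auto simp: cube_verts_def)
      then show ?case
        using insert R_trans by (auto simp: cube_verts_def)
    qed
  qed
  obtain s x i t y j where "u = (s, x, i)" "v = (t, y, j)"
    by (metis prod_cases3)
  moreover from this have "((s, {}, i), (t, {}, j)) \<in> R"
    using uv by (intro copies) (auto simp: cube_verts_def)
  ultimately show ?thesis
    using to_empty uv R_trans R_sym R_def by metis
qed

lemma realizable_if:
  fixes A :: "nat^2^2"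
  assumes sum: "A$1$1 + A$1$2 = k" "A$2$1 + A$2$2 = k" and pos: "A$1$2 > 0" "A$2$1 > 0"
  shows "\<exists>(G :: 'v::infinite pair_pre_digraph) V.
    pair_graph G \<and> Digraph_Component.connected (with_proj G) \<and> regular_graph G k \<and>
    color_adjacency_matrix G V A"
proof -
  define m where "m s = A $ s $ s" for s
  define n where "n s = (if s = 1 then A$2$1 else A$1$2)" for s :: 2
  define N where "N = max (m 1) (m 2)"
  have n_pos: "n s > 0" for s
    using pos by (simp add: n_def)
  have m_le: "m s \<le> N" for s
    using exhaust_2[of s] by (auto simp: N_def)
  show ?thesis
  proof (rule perfect_coloring_transfer[where W = "cube_verts N n" and E = "cube_arcs N m n"
        and c = fst])
    show "cube_arcs N m n \<subseteq> cube_verts N n \<times> cube_verts N n"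
      by (auto simp: cube_arcs_def)
    have "s \<in> fst ` cube_verts N n" for s
      by (rule image_eqI[of _ _ "(s, {}, 0)"]) (use n_pos in \<open>auto simp: cube_verts_def\<close>)
    then show "fst ` cube_verts N n = UNIV"
      by blast
    show "card {w. (u, w) \<in> cube_arcs N m n \<and> fst w = j} = A $ fst u $ j"
      if "u \<in> cube_verts N n" for u j
    proof -
      obtain s x i where u: "u = (s, x, i)"
        by (metis prod_cases3)
      show ?thesis
      proof (cases "s = j")
        case True
        then show ?thesis
          using card_cube_arcs_same[of s x i N n m] that m_le by (simp add: u m_def)
      next
        case False
        then have "n j = A $ s $ j"
          using exhaust_2[of s] exhaust_2[of j] by (auto simp: n_def)
        then show ?thesis
          using card_cube_arcs_other[of s x i N n j m] that False by (simp add: u)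
      qed
    qed
    show "(\<Sum>j\<in>UNIV. A $ i $ j) = k" for i
      using exhaust_2[of i] sum by (auto simp: UNIV_2)
  qed (use finite_cube_verts sym_cube_arcs irrefl_cube_arcs cube_arcs_connected N_def n_pos in auto)
qed

section \<open>Classification\<close>

lemma realizable_iff:
  "(\<exists>(G :: 'v::infinite pair_pre_digraph) (V :: 2 \<Rightarrow> 'v set).
      pair_graph G \<and> Digraph_Component.connected (with_proj G) \<and> regular_graph G k \<and>
      color_adjacency_matrix G V A)
   \<longleftrightarrow> A$1$1 + A$1$2 = k \<and> A$2$1 + A$2$2 = k \<and> A$1$2 > 0 \<and> A$2$1 > 0"
  (is "?L \<longleftrightarrow> ?R")
proof
  assume ?L
  then obtain G :: "'v pair_pre_digraph" and V where G:
    "pair_graph G" "Digraph_Component.connected (with_proj G)" "regular_graph G k"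
    "color_adjacency_matrix G V A"
    by blast
  then show ?R
    using color_adjacency_matrix_row_sum[OF G(1,3,4), of 1]
      color_adjacency_matrix_row_sum[OF G(1,3,4), of 2]
      color_adjacency_matrix_off_diagonal[OF G(1,2,4), of 1 2]
      color_adjacency_matrix_off_diagonal[OF G(1,2,4), of 2 1]
    by (simp add: UNIV_2)
next
  assume ?R
  then show ?L
    by (intro realizable_if) auto
qed

definition sorted_mats :: "nat \<Rightarrow> (nat^2^2) set" where
  "sorted_mats k = {mat2 a (k - a) (k - d) d | a d. a \<le> d \<and> d < k}"

lemma classification:
  assumes L: "set L = sorted_mats k" "distinct L"
  shows "(\<forall>A :: nat^2^2.
       (\<exists>(G :: 'v::infinite pair_pre_digraph) (V :: 2 \<Rightarrow> 'v set).
          pair_graph G \<and> Digraph_Component.connected (with_proj G) \<and> regular_graph G k \<and>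
          color_adjacency_matrix G V A)
       \<longleftrightarrow> (\<exists>B \<in> set L. equivalent_matrices A B)) \<and>
    (\<forall>i < length L. \<forall>j < length L. i \<noteq> j \<longrightarrow> \<not> equivalent_matrices (L ! i) (L ! j))"
proof (intro conjI allI impI)
  fix A :: "nat^2^2"
  have "(A$1$1 + A$1$2 = k \<and> A$2$1 + A$2$2 = k \<and> A$1$2 > 0 \<and> A$2$1 > 0) \<longleftrightarrow>
        (\<exists>B \<in> sorted_mats k. equivalent_matrices A B)" (is "?L \<longleftrightarrow> ?R")
  proof
    assume ?L
    define a d where "a = min (A$1$1) (A$2$2)" and "d = max (A$1$1) (A$2$2)"
    have "mat2 a (k - a) (k - d) d \<in> sorted_mats k"
      using \<open>?L\<close> unfolding sorted_mats_def a_def d_def by fastforce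
    moreover have "equivalent_matrices A (mat2 a (k - a) (k - d) d)"
      using \<open>?L\<close> by (auto simp: equivalent_matrices_2_iff matrix2_eq_iff a_def d_def min_def max_def)
    ultimately show ?R
      by blast
  next
    assume ?R
    then show ?L
      by (auto simp: sorted_mats_def equivalent_matrices_2_iff matrix2_eq_iff)
  qed
  then show "(\<exists>(G :: 'v pair_pre_digraph) (V :: 2 \<Rightarrow> 'v set).
          pair_graph G \<and> Digraph_Component.connected (with_proj G) \<and> regular_graph G k \<and>
          color_adjacency_matrix G V A)
       \<longleftrightarrow> (\<exists>B \<in> set L. equivalent_matrices A B)"
    unfolding realizable_iff L(1) .
next
  fix i j assume ij: "i < length L" "j < length L" "i \<noteq> j"
  \<comment> \<open>If the swap takes one sorted matrix to another, then both diagonals are constant.\<close>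
  have "A = B" if "A \<in> sorted_mats k" "B \<in> sorted_mats k" "equivalent_matrices A B" for A B
    using that by (auto simp: sorted_mats_def equivalent_matrices_2_iff matrix2_eq_iff)
  then show "\<not> equivalent_matrices (L ! i) (L ! j)"
    using ij L by (metis nth_eq_iff_index_eq nth_mem)
qed

lemma matrices3: "set matrices3 = sorted_mats 3" "distinct matrices3"
  and matrices4: "set matrices4 = sorted_mats 4" "distinct matrices4"
  and matrices5: "set matrices5 = sorted_mats 5" "distinct matrices5"
proof -
  have eq: "sorted_mats k = (\<Union>d\<in>{..<k}. (\<lambda>a. mat2 a (k - a) (k - d) d) ` {..d})" for k
    by (auto simp: sorted_mats_def)
  show "set matrices3 = sorted_mats 3" "set matrices4 = sorted_mats 4" "set matrices5 = sorted_mats 5"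
    unfolding eq
    by (auto simp: matrices3_def matrices4_def matrices5_def lessThan_nat_numeral lessThan_Suc
        atMost_Suc atMost_nat_numeral)
  show "distinct matrices3" "distinct matrices4" "distinct matrices5"
    by (simp_all add: matrices3_def matrices4_def matrices5_def matrix2_eq_iff)
qed

theorem mainTheorem2:
  shows "\<forall>(k, L) \<in> {(3, matrices3), (4, matrices4), (5, matrices5)}.
    (\<forall>A :: nat^2^2.
       (\<exists>(G :: 'v::infinite pair_pre_digraph) (V :: 2 \<Rightarrow> 'v set).
          pair_graph G \<and> Digraph_Component.connected (with_proj G) \<and> regular_graph G k \<and>
          color_adjacency_matrix G V A)
       \<longleftrightarrow> (\<exists>B \<in> set L. equivalent_matrices A B)) \<and>
    (\<forall>i < length L. \<forall>j < length L. i \<noteq> j \<longrightarrow> \<not> equivalent_matrices (L ! i) (L ! j))"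
  using classification[OF matrices3, where 'v = 'v] classification[OF matrices4, where 'v = 'v]
    classification[OF matrices5, where 'v = 'v]
  by simp

end
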